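(* Let $(a_k)_{k\ge1}$ and $(b_k)_{k\ge1}$ be sequences of complex numbers such that, for some $p$ with $\Re(p)>1$, $a_k=o(k^{-p})$ and $b_k=o(k^{-p})$ as $k\to\infty$. Put $A_n=\sum_{k=1}^n a_k$, $B_n=\sum_{k=1}^n b_k$, $A=\lim_{n\to\infty}A_n$, $B=\lim_{n\to\infty}B_n$, and for $x\in[-1,1]$ let $F_n(A,B;x)=\sum_{k=1}^n (A-A_k)(B-B_k)x^k$. Then for every $x\in[-1,1]$ and every positive integer $n$, \begin{align*} (1-x)F_n(A,B;x) ={}& ABx-(A-A_n)(B-B_n)x^{n+1}-\Big(\sum_{k=1}^n a_kx^k\Big)(B-B_n)-\Big(\sum_{k=1}^n b_kx^k\Big)(A-A_n)\\ &-\sum_{k=1}^n\Big(\sum_{i=1}^k a_ix^i\Big)b_k-\sum_{k=1}^n\Big(\sum_{i=1}^k b_ix^i\Big)a_k+\sum_{k=1}^n a_kb_kx^k . \end{align*}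
   Context: $A$ and $B$ are the sums of the convergent series $\sum a_k$ and $\sum b_k$, and $A_n,B_n$ their partial sums. *)

theory Defs
  imports "HOL-Analysis.Analysis" "HOL-Library.Landau_Symbols"
begin

(* Sequences (a_k), k >= 1, are functions on nat whose value at 0 is never used. *)

definition partial_sum :: "(nat \<Rightarrow> complex) \<Rightarrow> nat \<Rightarrow> complex" where
  "partial_sum a n = (\<Sum>k=1..n. a k)"

definition series_sum :: "(nat \<Rightarrow> complex) \<Rightarrow> complex" where
  "series_sum a = lim (partial_sum a)"

(* F_n(A,B;x), where A, A_k, B, B_k are determined by the sequences a and b. *)
definition F :: "nat \<Rightarrow> (nat \<Rightarrow> complex) \<Rightarrow> (nat \<Rightarrow> complex) \<Rightarrow> real \<Rightarrow> complex" where
  "F n a b x = (\<Sum>k=1..n. (series_sum a - partial_sum a k) * (series_sum b - partial_sum b k)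
                            * of_real x ^ k)"

end

theory Submission
  imports Defs
begin

text \<open>Summation by parts twice: the factor \<open>1 - x\<close> turns tail products into
  differences made of a term times a tail, and summing these by parts gives the double sums. Each
  yields one surplus diagonal sum; the differences cost one, so one remains.\<close>

text \<open>
  The identity is purely algebraic: it holds for arbitrary constants \<open>A\<close>, \<open>B\<close> in
  place of the sums of the series, by induction on \<open>n\<close>.
\<close>

lemma sum_tail_products:
  fixes a b :: "nat \<Rightarrow> 'a::comm_ring_1" and A B x :: 'a
  shows "(1 - x) * (\<Sum>k=1..n. (A - (\<Sum>i=1..k. a i)) * (B - (\<Sum>i=1..k. b i)) * x ^ k) =
      A * B * x
    - (A - (\<Sum>i=1..n. a i)) * (B - (\<Sum>i=1..n. b i)) * x ^ (n + 1)
    - (\<Sum>k=1..n. a k * x ^ k) * (B - (\<Sum>i=1..n. b i))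
    - (\<Sum>k=1..n. b k * x ^ k) * (A - (\<Sum>i=1..n. a i))
    - (\<Sum>k=1..n. (\<Sum>i=1..k. a i * x ^ i) * b k)
    - (\<Sum>k=1..n. (\<Sum>i=1..k. b i * x ^ i) * a k)
    + (\<Sum>k=1..n. a k * b k * x ^ k)"
proof (induction n)
  case 0
  show ?case by simp
next
  case (Suc n)
  show ?case
    \<comment> \<open>The new terms of the double sums cancel the change of tails in the boundary
      products; what remains is the expanded new tail product.\<close>
    unfolding sum.cl_ivl_Suc distrib_left [of "1 - x"]
    using Suc.IH by (simp add: algebra_simps)
qed

theorem theorem1p1:
  fixes a b :: "nat \<Rightarrow> complex" and p :: complex and x :: real and n :: nat
  assumes "Re p > 1"
    and "a \<in> o(\<lambda>k. of_nat k powr (- p))"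
    and "b \<in> o(\<lambda>k. of_nat k powr (- p))"
    and "x \<in> {-1..1}"
    and "n \<ge> 1"
  shows "(1 - of_real x) * F n a b x =
      series_sum a * series_sum b * of_real x
    - (series_sum a - partial_sum a n) * (series_sum b - partial_sum b n) * of_real x ^ (n + 1)
    - (\<Sum>k=1..n. a k * of_real x ^ k) * (series_sum b - partial_sum b n)
    - (\<Sum>k=1..n. b k * of_real x ^ k) * (series_sum a - partial_sum a n)
    - (\<Sum>k=1..n. (\<Sum>i=1..k. a i * of_real x ^ i) * b k)
    - (\<Sum>k=1..n. (\<Sum>i=1..k. b i * of_real x ^ i) * a k)
    + (\<Sum>k=1..n. a k * b k * of_real x ^ k)"
  unfolding F_def partial_sum_def by (rule sum_tail_products)

end
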